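(* Let $G$ and $H$ be nontrivial, connected graphs both of which have girth at least $4$. The Cartesian product $G\,\Box\, H$ is well-dominated if and only if $G = H = K_2$ (up to isomorphism).
   Context: All graphs are finite and simple. A graph is nontrivial if it has at least $2$ vertices. The girth of a graph is the length of its shortest cycle; "girth at least $4$" means triangle-free (acyclic graphs, having infinite girth, are included). A set $D\subseteq V(G)$ is a dominating set of $G$ if every vertex of $G$ is in $D$ or adjacent to a vertex of $D$. A graph is well-dominated if all of its minimal (with respect to inclusion) dominating sets have the same cardinality. The Cartesian product $G\,\Box\, H$ has vertex set $V(G)\times V(H)$, and $(g_1,h_1)$, $(g_2,h_2)$ are adjacent iff ($g_1=g_2$ and $h_1h_2\in E(H)$) or ($h_1=h_2$ and $g_1g_2\in E(G)$). $K_n$ is the complete graph on $n$ vertices. *)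

theory Defs
  imports "Graph_Theory.Graph_Theory" "HOL-Library.Extended_Nat"
begin

text \<open>
  A finite simple graph is a \<open>pair_graph\<close>: a finite, loop-free, symmetric digraph whose arcs are
  pairs of vertices; an undirected edge \<open>uv\<close> is the pair of arcs \<open>(u,v)\<close>, \<open>(v,u)\<close>.
\<close>

text \<open>
  \<open>pre_digraph.cycle\<close> also accepts the closed walk \<open>u,v,u\<close> along a single undirected edge; the
  bound on the length excludes it. The girth of an acyclic graph is \<open>Inf {} = \<infinity>\<close>.
\<close>
definition girth :: "'a pair_pre_digraph \<Rightarrow> enat" where
  "girth G = (INF p \<in> {p. pre_digraph.cycle (with_proj G) p \<and> 3 \<le> length p}. enat (length p))"

definition dominating_set :: "'a pair_pre_digraph \<Rightarrow> 'a set \<Rightarrow> bool" where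
  "dominating_set G D \<longleftrightarrow>
     D \<subseteq> pverts G \<and> (\<forall>v \<in> pverts G. v \<in> D \<or> (\<exists>u \<in> D. (v, u) \<in> parcs G))"

definition minimal_dominating_set :: "'a pair_pre_digraph \<Rightarrow> 'a set \<Rightarrow> bool" where
  "minimal_dominating_set G D \<longleftrightarrow> dominating_set G D \<and> (\<forall>D'. D' \<subset> D \<longrightarrow> \<not> dominating_set G D')"

definition well_dominated :: "'a pair_pre_digraph \<Rightarrow> bool" where
  "well_dominated G \<longleftrightarrow>
     (\<forall>D D'. minimal_dominating_set G D \<longrightarrow> minimal_dominating_set G D' \<longrightarrow> card D = card D')"

definition cartesian_product ::
    "'a pair_pre_digraph \<Rightarrow> 'b pair_pre_digraph \<Rightarrow> ('a \<times> 'b) pair_pre_digraph" where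
  "cartesian_product G H =
     \<lparr> pverts = pverts G \<times> pverts H,
       parcs = {((g1, h1), (g2, h2)) | g1 h1 g2 h2.
                  g1 \<in> pverts G \<and> g1 = g2 \<and> (h1, h2) \<in> parcs H \<or>
                  h1 \<in> pverts H \<and> h1 = h2 \<and> (g1, g2) \<in> parcs G} \<rparr>"

lemma pair_graph_cartesian_product:
  assumes "pair_graph G" and "pair_graph H"
  shows "pair_graph (cartesian_product G H)"
proof -
  interpret G: pair_graph G by fact
  interpret H: pair_graph H by fact
  let ?P = "cartesian_product G H"
  have sub: "parcs ?P \<subseteq> pverts ?P \<times> pverts ?P"
    by (auto simp: cartesian_product_def dest: G.wellformed' H.wellformed')
  have fin: "finite (pverts ?P)"
    by (simp add: cartesian_product_def)
  have symG: "(b, a) \<in> parcs G" if "(a, b) \<in> parcs G" for a b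
    using G.sym_arcs that by (auto simp: symmetric_def dest: symD)
  have symH: "(b, a) \<in> parcs H" if "(a, b) \<in> parcs H" for a b
    using H.sym_arcs that by (auto simp: symmetric_def dest: symD)
  show ?thesis
  proof
    show "finite (pverts ?P)" by (rule fin)
    show "finite (parcs ?P)" using sub fin by (meson finite_SigmaI finite_subset)
    show "symmetric (with_proj ?P)"
      unfolding symmetric_def with_proj_simps
      by (rule symI) (auto simp: cartesian_product_def dest: symG symH)
  next
    fix e assume e: "e \<in> parcs ?P"
    show "fst e \<in> pverts ?P" "snd e \<in> pverts ?P" using sub e by auto
    show "fst e \<noteq> snd e"
      using e by (auto simp: cartesian_product_def dest: G.no_loops' H.no_loops')
  qed
qed

end

theory Submission
  imports Defs
begin

text \<open>
  If \<open>D\<close> and \<open>E\<close> are dominating sets of \<open>G\<close> and \<open>H\<close> all of whose members have an external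
  private neighbour, then \<open>D \<times> V(H)\<close> and \<open>V(G) \<times> E\<close> are minimal dominating sets of the
  product, so in a well-dominated product no dominating set is smaller than these. Comparing with
  the dominating set \<open>V(G) \<times> {v} \<union> D \<times> (V(H) - N[v])\<close> gives
  \<open>|D| (deg v + 1) \<le> |V(G)| \<le> |D| (\<Delta>(G) + 1)\<close>. By symmetry both maximum degrees are the same
  number \<open>k\<close> and all these inequalities are equalities: \<open>D\<close> and \<open>E\<close> are perfect codes
  consisting of vertices of degree \<open>k\<close>. Since the dominating set just mentioned is now minimal,
  every such \<open>v\<close> has a leaf neighbour. Counting one further minimal dominating set shows that
  every vertex \<open>a\<close> of \<open>G\<close> has exactly \<open>deg a + 1 - k\<close> leaf neighbours. If \<open>k \<ge> 2\<close>, applying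
  this to a leaf gives \<open>k = 2\<close>, and applying it along a path starting at a vertex of \<open>D\<close> yields
  a leaf that \<open>D\<close> does not dominate. So \<open>k = 1\<close>.
\<close>

section \<open>Dominating sets\<close>

lemma dominating_set_mono:
  assumes "dominating_set G D" "D \<subseteq> D'" "D' \<subseteq> pverts G"
  shows "dominating_set G D'"
  using assms unfolding dominating_set_def by blast

text \<open>Supersets of a dominating set inside the vertex set still dominate, so deleting one
  vertex at a time tests all proper subsets.\<close>

lemma minimal_dominating_setI:
  assumes "dominating_set G D" and "\<And>x. x \<in> D \<Longrightarrow> \<not> dominating_set G (D - {x})"
  shows "minimal_dominating_set G D"
  unfolding minimal_dominating_set_def
proof (intro conjI allI impI notI)
  fix D' assume sub: "D' \<subset> D" and dom: "dominating_set G D'"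
  then obtain x where x: "x \<in> D" "D' \<subseteq> D - {x}"
    by blast
  have "dominating_set G (D - {x})"
    using dominating_set_mono[OF dom x(2)] assms(1) unfolding dominating_set_def by blast
  with assms(2)[OF x(1)] show False ..
qed fact

lemma dominating_set_contains_minimal:
  assumes "finite D" "dominating_set G D"
  shows "\<exists>M \<subseteq> D. minimal_dominating_set G M"
  using assms
proof (induction D rule: finite_psubset_induct)
  case (psubset D)
  show ?case
  proof (cases "minimal_dominating_set G D")
    case True
    then show ?thesis by blast
  next
    case False
    then obtain D' where D': "D' \<subset> D" "dominating_set G D'"
      using psubset.prems unfolding minimal_dominating_set_def by blast
    then obtain M where "M \<subseteq> D'" "minimal_dominating_set G M"
      using psubset.IH by blast
    then show ?thesis
      using D'(1) by blast
  qed
qed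

section \<open>Domination in Cartesian products\<close>

lemma dominating_set_cartesian_product_iff:
  "dominating_set (cartesian_product G H) F \<longleftrightarrow>
     F \<subseteq> pverts G \<times> pverts H \<and>
     (\<forall>g \<in> pverts G. \<forall>h \<in> pverts H. (g, h) \<in> F \<or>
       (\<exists>h'. (g, h') \<in> F \<and> (h, h') \<in> parcs H) \<or> (\<exists>g'. (g', h) \<in> F \<and> (g, g') \<in> parcs G))"
proof -
  have arc: "((g, h), x) \<in> parcs (cartesian_product G H) \<longleftrightarrow>
    (\<exists>h'. x = (g, h') \<and> g \<in> pverts G \<and> (h, h') \<in> parcs H) \<or>
    (\<exists>g'. x = (g', h) \<and> h \<in> pverts H \<and> (g, g') \<in> parcs G)" for g h x
    unfolding cartesian_product_def by (cases x) auto
  have "(\<exists>x \<in> F. ((g, h), x) \<in> parcs (cartesian_product G H)) \<longleftrightarrow>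
    (\<exists>h'. (g, h') \<in> F \<and> (h, h') \<in> parcs H) \<or> (\<exists>g'. (g', h) \<in> F \<and> (g, g') \<in> parcs G)"
    if "g \<in> pverts G" "h \<in> pverts H" for g h
    unfolding arc using that by blast
  moreover have "pverts (cartesian_product G H) = pverts G \<times> pverts H"
    unfolding cartesian_product_def by simp
  ultimately show ?thesis
    unfolding dominating_set_def by auto
qed

lemma not_dominating_cartesian_productI:
  assumes "g \<in> pverts G" "h \<in> pverts H" "(g, h) \<notin> F"
    and "\<And>h'. (h, h') \<in> parcs H \<Longrightarrow> (g, h') \<notin> F" and "\<And>g'. (g, g') \<in> parcs G \<Longrightarrow> (g', h) \<notin> F"
  shows "\<not> dominating_set (cartesian_product G H) F"
  using assms unfolding dominating_set_cartesian_product_iff by blast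

lemma dominating_set_cartesian_product_swap:
  "dominating_set (cartesian_product H G) (prod.swap ` F) \<longleftrightarrow>
     dominating_set (cartesian_product G H) F"
proof -
  have "prod.swap ` F \<subseteq> pverts H \<times> pverts G \<longleftrightarrow> F \<subseteq> pverts G \<times> pverts H"
    by auto
  moreover have mem: "(h, g) \<in> prod.swap ` F \<longleftrightarrow> (g, h) \<in> F" for g h
    by force
  ultimately show ?thesis
    unfolding dominating_set_cartesian_product_iff mem by blast
qed

lemma minimal_dominating_set_cartesian_product_swap:
  assumes "minimal_dominating_set (cartesian_product H G) F"
  shows "minimal_dominating_set (cartesian_product G H) (prod.swap ` F)"
  unfolding minimal_dominating_set_def
proof (intro conjI allI impI notI)
  show "dominating_set (cartesian_product G H) (prod.swap ` F)"
    using assms unfolding minimal_dominating_set_def dominating_set_cartesian_product_swap by blast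
next
  fix F' assume "F' \<subset> prod.swap ` F" and dom: "dominating_set (cartesian_product G H) F'"
  then have "prod.swap ` F' \<subset> prod.swap ` prod.swap ` F"
    by (metis inj_image_subset_iff inj_swap psubset_eq subset_image_inj inj_image_eq_iff)
  then have "prod.swap ` F' \<subset> F"
    by (simp add: image_image)
  then show False
    using assms dom unfolding minimal_dominating_set_def
    by (metis dominating_set_cartesian_product_swap)
qed

text \<open>This symmetry lets every result about one factor be reused with the factors
  exchanged.\<close>

lemma well_dominated_cartesian_product_swap:
  assumes "well_dominated (cartesian_product G H)"
  shows "well_dominated (cartesian_product H G)"
  unfolding well_dominated_def
proof (intro allI impI)
  fix D D'
  assume "minimal_dominating_set (cartesian_product H G) D"
    "minimal_dominating_set (cartesian_product H G) D'"
  then have "card (prod.swap ` D) = card (prod.swap ` D')"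
    using assms minimal_dominating_set_cartesian_product_swap
    unfolding well_dominated_def by blast
  then show "card D = card D'"
    by (simp add: card_image)
qed

section \<open>Neighbourhoods, leaves and private neighbours\<close>

definition nbrs :: "'a pair_pre_digraph \<Rightarrow> 'a \<Rightarrow> 'a set" where
  "nbrs G v = {w. (v, w) \<in> parcs G}"

definition leaves :: "'a pair_pre_digraph \<Rightarrow> 'a \<Rightarrow> 'a set" where
  "leaves G v = {w \<in> nbrs G v. nbrs G w = {v}}"

text \<open>The vertex \<open>w\<close> is an external private neighbour of \<open>d\<close>. As it
  lies outside \<open>D\<close>, its copies certify that D x V(H) is minimal in the product.\<close>

definition privately_dominating :: "'a pair_pre_digraph \<Rightarrow> 'a set \<Rightarrow> bool" where
  "privately_dominating G D \<longleftrightarrow> dominating_set G D \<and>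
     (\<forall>d \<in> D. \<exists>w. w \<in> nbrs G d \<and> w \<notin> D \<and> (\<forall>d' \<in> D. w \<in> nbrs G d' \<longrightarrow> d' = d))"

section \<open>Triangle-free graphs without isolated vertices\<close>

text \<open>Of nontriviality and connectedness the counting arguments retain only
  \<open>no_isolated\<close> and \<open>nonempty\<close>; connectedness itself returns in
  \<open>complete_digraph_2I\<close>.\<close>

locale triangle_free_graph = pair_graph G for G :: "'a pair_pre_digraph" +
  assumes triangle_free: "(u, v) \<in> parcs G \<Longrightarrow> (v, w) \<in> parcs G \<Longrightarrow> (u, w) \<notin> parcs G"
    and no_isolated: "v \<in> pverts G \<Longrightarrow> nbrs G v \<noteq> {}"
    and nonempty: "pverts G \<noteq> {}"
begin

lemma adj_sym: "(u, v) \<in> parcs G \<Longrightarrow> (v, u) \<in> parcs G"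
  using sym_arcs by (auto simp: symmetric_def dest: symD)

lemma adj_irrefl: "(v, v) \<notin> parcs G"
  using no_loops' by blast

lemma nbrs_sym: "w \<in> nbrs G v \<longleftrightarrow> v \<in> nbrs G w"
  unfolding nbrs_def using adj_sym by blast

lemma nbrs_irrefl: "v \<notin> nbrs G v"
  unfolding nbrs_def using adj_irrefl by blast

lemma nbrs_subset: "nbrs G v \<subseteq> pverts G"
  unfolding nbrs_def by (auto dest: in_arcsD2)

lemma finite_nbrs: "finite (nbrs G v)"
  using finite_subset[OF nbrs_subset pair_finite_verts] .

lemma nbrs_triangle_free: "v \<in> nbrs G u \<Longrightarrow> w \<in> nbrs G v \<Longrightarrow> w \<notin> nbrs G u"
  unfolding nbrs_def using triangle_free by blast

lemma dominating_set_iff: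
  "dominating_set G D \<longleftrightarrow> D \<subseteq> pverts G \<and> (\<forall>v \<in> pverts G. v \<in> D \<or> (\<exists>d \<in> D. v \<in> nbrs G d))"
  unfolding dominating_set_def nbrs_def using adj_sym by blast

text \<open>
  Bollobas and Cockayne: a minimum dominating set inducing as many edges as possible works, since a
  vertex without external private neighbour could be replaced by one of its neighbours.
\<close>
lemma privately_dominating_exists: "\<exists>D. privately_dominating G D"
proof -
  have domV: "dominating_set G (pverts G)"
    unfolding dominating_set_def by blast
  obtain k where k: "\<exists>D. dominating_set G D \<and> card D = k"
    and k_min: "\<And>D. dominating_set G D \<Longrightarrow> k \<le> card D"
  proof -
    let ?P = "\<lambda>k. \<exists>D. dominating_set G D \<and> card D = k"
    have "?P (LEAST k. ?P k)"
      by (rule LeastI[of ?P "card (pverts G)"]) (use domV in blast)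
    moreover have "(LEAST k. ?P k) \<le> card D" if "dominating_set G D" for D
      by (rule Least_le) (use that in blast)
    ultimately show ?thesis using that by blast
  qed
  let ?Q = "\<lambda>D. dominating_set G D \<and> card D = k"
  \<comment> \<open>This counts every induced edge twice, which does not change the
    maximisers.\<close>
  let ?e = "\<lambda>D. card (parcs G \<inter> D \<times> D)"
  obtain D0 where "?Q D0" using k by blast
  moreover have "\<forall>D. ?Q D \<longrightarrow> ?e D < Suc (card (parcs G))"
    by (auto simp: less_Suc_eq_le intro!: card_mono pair_finite_arcs)
  ultimately obtain D where D: "?Q D" and e_max: "\<And>D'. ?Q D' \<Longrightarrow> ?e D' \<le> ?e D"
    using ex_has_greatest_nat[of ?Q D0 ?e "Suc (card (parcs G))"] by blast
  have DV: "D \<subseteq> pverts G" and cov: "\<And>v. v \<in> pverts G \<Longrightarrow> v \<in> D \<or> (\<exists>d \<in> D. v \<in> nbrs G d)"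
    using D unfolding dominating_set_iff by auto
  have finD: "finite D"
    using DV pair_finite_verts finite_subset by blast
  have "\<exists>w. w \<in> nbrs G d \<and> w \<notin> D \<and> (\<forall>d' \<in> D. w \<in> nbrs G d' \<longrightarrow> d' = d)" if d: "d \<in> D" for d
  proof (rule ccontr)
    assume "\<not> ?thesis"
    then have other: "\<And>w. w \<in> nbrs G d \<Longrightarrow> w \<notin> D \<Longrightarrow> \<exists>d' \<in> D - {d}. w \<in> nbrs G d'"
      by blast
    \<comment> \<open>Deleting \<open>d\<close> can thus leave only \<open>d\<close> itself
      undominated.\<close>
    have cov': "v \<in> D \<or> (\<exists>d' \<in> D - {d}. v \<in> nbrs G d')" if "v \<in> pverts G" for v
      using cov[OF that] other by blast
    \<comment> \<open>A neighbour of \<open>d\<close> in \<open>D\<close> would dominate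
      \<open>d\<close>, making \<open>D - {d}\<close> a dominating set with fewer than
      \<open>k\<close> elements.\<close>
    have d_alone: "x \<notin> nbrs G d" if "x \<in> D" for x
    proof
      assume x: "x \<in> nbrs G d"
      have "x \<noteq> d" using x nbrs_irrefl by blast
      moreover have "d \<in> nbrs G x" using x nbrs_sym by blast
      ultimately have "dominating_set G (D - {d})"
        unfolding dominating_set_iff using DV cov' that by blast
      then show False
        using k_min[of "D - {d}"] D d finD
        by (metis card_Diff1_less not_le)
    qed
    obtain w where w: "w \<in> nbrs G d"
      using no_isolated DV d by blast
    then have wD: "w \<notin> D" using d_alone by blast
    obtain d' where d': "d' \<in> D - {d}" "w \<in> nbrs G d'"
      using other[OF w wD] by blast
    let ?D' = "insert w (D - {d})"
    have "dominating_set G ?D'"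
      unfolding dominating_set_iff
    proof (intro conjI ballI)
      show "?D' \<subseteq> pverts G" using DV w nbrs_subset by blast
    next
      fix v assume v: "v \<in> pverts G"
      have "d \<in> nbrs G w" using w nbrs_sym by blast
      then show "v \<in> ?D' \<or> (\<exists>d \<in> ?D'. v \<in> nbrs G d)"
        using cov'[OF v] by blast
    qed
    moreover have "card ?D' = k"
      using D finD wD d by (metis card.insert card_Suc_Diff1 finite_Diff Diff_iff)
    ultimately have le: "?e ?D' \<le> ?e D"
      using e_max by blast
    \<comment> \<open>No arc inside \<open>D\<close> touches \<open>d\<close>, so exchanging
      \<open>d\<close> for \<open>w\<close> loses none, while the arc from \<open>d'\<close> to
      \<open>w\<close> is new.\<close>
    have "parcs G \<inter> D \<times> D \<subset> parcs G \<inter> ?D' \<times> ?D'"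
    proof (rule psubsetI)
      show "parcs G \<inter> D \<times> D \<subseteq> parcs G \<inter> ?D' \<times> ?D'"
        using d_alone adj_sym unfolding nbrs_def by blast
      have "(d', w) \<in> parcs G \<inter> ?D' \<times> ?D'"
        using d' unfolding nbrs_def by blast
      then show "parcs G \<inter> D \<times> D \<noteq> parcs G \<inter> ?D' \<times> ?D'"
        using wD by blast
    qed
    then have "?e D < ?e ?D'"
      by (intro psubset_card_mono) (auto intro: pair_finite_arcs)
    with le show False by simp
  qed
  then show ?thesis
    using D unfolding privately_dominating_def by blast
qed

lemma dominating_set_nonempty: "dominating_set G D \<Longrightarrow> D \<noteq> {}"
  using nonempty unfolding dominating_set_iff by blast

section \<open>Counting by closed neighbourhoods\<close>

lemma card_verts_le_sum:
  assumes "dominating_set G D"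
  shows "card (pverts G) \<le> (\<Sum>d\<in>D. card (insert d (nbrs G d)))"
proof -
  have fin: "finite D"
    using assms pair_finite_verts finite_subset unfolding dominating_set_def by blast
  have "pverts G \<subseteq> (\<Union>d\<in>D. insert d (nbrs G d))"
    using assms unfolding dominating_set_iff by blast
  then have "card (pverts G) \<le> card (\<Union>d\<in>D. insert d (nbrs G d))"
    by (rule card_mono[rotated]) (simp add: fin finite_nbrs)
  also have "\<dots> \<le> (\<Sum>d\<in>D. card (insert d (nbrs G d)))"
    by (rule card_UN_le[OF fin])
  finally show ?thesis .
qed

lemma card_insert_nbrs: "card (insert v (nbrs G v)) = Suc (card (nbrs G v))"
  by (simp add: finite_nbrs nbrs_irrefl)

lemma card_verts_le:
  assumes "dominating_set G D" and "\<And>v. v \<in> pverts G \<Longrightarrow> card (nbrs G v) \<le> k"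
  shows "card (pverts G) \<le> card D * (k + 1)"
proof -
  have "(\<Sum>d\<in>D. card (insert d (nbrs G d))) \<le> card D * (k + 1)"
    using sum_bounded_above[of D "\<lambda>d. card (insert d (nbrs G d))" "k + 1"] assms
    unfolding dominating_set_def by (force simp: card_insert_nbrs)
  then show ?thesis
    using card_verts_le_sum[OF assms(1)] by simp
qed

text \<open>The closed neighbourhoods of \<open>D\<close> cover the graph and have at most
  \<open>k + 1\<close> elements each. Equality leaves no slack: none is smaller and no two
  overlap.\<close>

lemma perfect_code:
  assumes dom: "dominating_set G D" and deg: "\<forall>v \<in> pverts G. card (nbrs G v) \<le> k"
    and eq: "card (pverts G) = card D * (k + 1)"
  shows "d \<in> D \<Longrightarrow> card (nbrs G d) = k"
    and "d \<in> D \<Longrightarrow> e \<in> D \<Longrightarrow> d \<noteq> e \<Longrightarrow> insert d (nbrs G d) \<inter> insert e (nbrs G e) = {}"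
proof -
  let ?N = "\<lambda>d. insert d (nbrs G d)"
  have DV: "D \<subseteq> pverts G" using dom unfolding dominating_set_def by blast
  have fin: "finite D"
    using DV pair_finite_verts finite_subset by blast
  have le: "card (?N d) \<le> k + 1" if "d \<in> D" for d
    using deg that DV by (simp add: card_insert_nbrs subset_iff)
  show "card (nbrs G d) = k" if d: "d \<in> D"
  proof (rule ccontr)
    assume "card (nbrs G d) \<noteq> k"
    then have "card (?N d) < k + 1"
      using le[OF d] by (simp add: card_insert_nbrs)
    then have "(\<Sum>d\<in>D. card (?N d)) < (\<Sum>d\<in>D. k + 1)"
      using le d fin by (intro sum_strict_mono_ex1) auto
    then show False
      using card_verts_le_sum[OF dom] eq by simp
  qed
  show "?N d \<inter> ?N e = {}" if d: "d \<in> D" and e: "e \<in> D" and ne: "d \<noteq> e"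
  proof (rule ccontr)
    assume "?N d \<inter> ?N e \<noteq> {}"
    then obtain x where x: "x \<in> ?N d" "x \<in> ?N e" by blast
    \<comment> \<open>The incidence \<open>(e, x)\<close> is redundant because \<open>x\<close> is
      already covered from \<open>d\<close>; dropping it makes the count strict.\<close>
    have "pverts G \<subseteq> snd ` ((SIGMA d:D. ?N d) - {(e, x)})"
    proof
      fix v assume "v \<in> pverts G"
      then obtain f where f: "f \<in> D" "v \<in> ?N f"
        using dom unfolding dominating_set_iff by blast
      show "v \<in> snd ` ((SIGMA d:D. ?N d) - {(e, x)})"
        using f x d ne by (cases "(f, v) = (e, x)") force+
    qed
    then have "card (pverts G) \<le> card ((SIGMA d:D. ?N d) - {(e, x)})"
      by (rule surj_card_le[rotated]) (simp add: fin finite_nbrs)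
    also have "\<dots> < card (SIGMA d:D. ?N d)"
      using e x by (intro card_Diff1_less) (auto simp: fin finite_nbrs)
    also have "\<dots> = (\<Sum>d\<in>D. card (?N d))"
      by (simp add: fin finite_nbrs card_SigmaI)
    also have "\<dots> \<le> (\<Sum>d\<in>D. k + 1)"
      by (rule sum_mono) (rule le)
    finally show False using eq by simp
  qed
qed

end

section \<open>Well-dominated products\<close>

locale well_dominated_product =
  G: triangle_free_graph G + H: triangle_free_graph H
  for G :: "'a pair_pre_digraph" and H :: "'b pair_pre_digraph" +
  assumes well_dominated: "well_dominated (cartesian_product G H)"
begin

lemma swap: "well_dominated_product H G"
  by unfold_locales (rule well_dominated_cartesian_product_swap[OF well_dominated])

section \<open>Dominating sets built from layers\<close>

lemma minimal_layers:
  assumes "privately_dominating G D"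
  shows "minimal_dominating_set (cartesian_product G H) (D \<times> pverts H)"
proof (rule minimal_dominating_setI)
  have dom: "dominating_set G D" using assms unfolding privately_dominating_def by blast
  show "dominating_set (cartesian_product G H) (D \<times> pverts H)"
    using dom[unfolded dominating_set_def] unfolding dominating_set_cartesian_product_iff by blast
  fix x assume "x \<in> D \<times> pverts H"
  then obtain d h where x: "x = (d, h)" "d \<in> D" "h \<in> pverts H" by blast
  obtain w where w: "w \<in> nbrs G d" "w \<notin> D" "\<forall>d' \<in> D. w \<in> nbrs G d' \<longrightarrow> d' = d"
    using assms x(2) unfolding privately_dominating_def by blast
  have "w \<in> pverts G" using w(1) G.nbrs_subset by blast
  moreover have "g' = d" if "g' \<in> D" "(w, g') \<in> parcs G" for g'
    using that w(3) G.adj_sym unfolding nbrs_def by blast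
  ultimately show "\<not> dominating_set (cartesian_product G H) (D \<times> pverts H - {x})"
    using w(2) x unfolding dominating_set_cartesian_product_iff by blast
qed

lemma card_minimal:
  assumes "privately_dominating G D" "minimal_dominating_set (cartesian_product G H) F"
  shows "card F = card D * card (pverts H)"
  using minimal_layers[OF assms(1)] assms(2) well_dominated
  unfolding well_dominated_def by (metis card_cartesian_product)

lemma card_dominating:
  assumes "privately_dominating G D" "dominating_set (cartesian_product G H) F"
  shows "card D * card (pverts H) \<le> card F"
proof -
  have "finite F"
    using assms(2) finite_subset G.pair_finite_verts H.pair_finite_verts
    unfolding dominating_set_cartesian_product_iff by blast
  then obtain M where "M \<subseteq> F" "minimal_dominating_set (cartesian_product G H) M"
    using dominating_set_contains_minimal assms(2) by blast
  then show ?thesis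
    using card_minimal[OF assms(1)] card_mono[OF \<open>finite F\<close>] by metis
qed

text \<open>The full copy of G over \<open>v\<close> dominates everything over the closed
  neighbourhood of \<open>v\<close>; over every other vertex a copy of \<open>D\<close> does the
  work.\<close>

abbreviation star_layers :: "'a set \<Rightarrow> 'b \<Rightarrow> ('a \<times> 'b) set" where
  "star_layers D v \<equiv> pverts G \<times> {v} \<union> D \<times> (pverts H - insert v (nbrs H v))"

text \<open>Stated as a sum to avoid truncated subtraction.\<close>

lemma card_star_layers:
  assumes "D \<subseteq> pverts G" "v \<in> pverts H"
  shows "card (star_layers D v) + card D * (card (nbrs H v) + 1)
    = card (pverts G) + card D * card (pverts H)"
proof -
  let ?R = "pverts H - insert v (nbrs H v)"
  have sub: "insert v (nbrs H v) \<subseteq> pverts H" using assms H.nbrs_subset by blast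
  have card_R: "card ?R + (card (nbrs H v) + 1) = card (pverts H)"
    using card_Diff_subset[OF _ sub] card_mono[OF H.pair_finite_verts sub]
    by (simp add: H.finite_nbrs H.card_insert_nbrs)
  have "finite D" using assms(1) finite_subset[OF _ G.pair_finite_verts] by blast
  then have "card (star_layers D v) = card (pverts G) + card D * card ?R"
    by (subst card_Un_disjoint)
      (auto simp: card_cartesian_product G.pair_finite_verts H.pair_finite_verts)
  then show ?thesis
    by (simp flip: card_R add: algebra_simps)
qed

text \<open>Compared with D x V(H), the set \<open>star_layers D v\<close> saves a copy of
  \<open>D\<close> over each vertex of the closed neighbourhood of \<open>v\<close> and pays one
  copy of V(G). By \<open>card_dominating\<close> it cannot be smaller.\<close>

lemma degree_bound:
  assumes D: "privately_dominating G D" and v: "v \<in> pverts H"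
  shows "card D * (card (nbrs H v) + 1) \<le> card (pverts G)"
proof -
  have dom: "dominating_set G D" using D unfolding privately_dominating_def by blast
  then have DV: "D \<subseteq> pverts G" unfolding dominating_set_def by blast
  have "dominating_set (cartesian_product G H) (star_layers D v)"
    using dom[unfolded dominating_set_def] v H.adj_sym
    unfolding dominating_set_cartesian_product_iff nbrs_def by blast
  then show ?thesis
    using card_dominating[OF D] card_star_layers[OF DV v] by fastforce
qed

text \<open>Under \<open>tight\<close>, \<open>star_layers D v\<close> has the least possible size.
  Without a leaf at \<open>v\<close>, a point \<open>(d, v)\<close> with \<open>d\<close> in
  \<open>D\<close> could be deleted from it.\<close>

lemma leaves_nonempty:
  assumes D: "privately_dominating G D" and v: "v \<in> pverts H"
    and tight: "card (pverts G) = card D * (card (nbrs H v) + 1)"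
  shows "leaves H v \<noteq> {}"
proof
  assume no_leaf: "leaves H v = {}"
  have dom: "dominating_set G D" using D unfolding privately_dominating_def by blast
  then have DV: "D \<subseteq> pverts G" unfolding dominating_set_def by blast
  obtain d where d: "d \<in> D" using G.dominating_set_nonempty[OF dom] by blast
  have dV: "d \<in> pverts G" using d dom unfolding dominating_set_def by blast
  let ?F = "star_layers D v - {(d, v)}"
  have "dominating_set (cartesian_product G H) ?F"
    unfolding dominating_set_cartesian_product_iff
  proof (intro conjI ballI)
    show "?F \<subseteq> pverts G \<times> pverts H"
      using v dom unfolding dominating_set_def by blast
  next
    fix g h assume g: "g \<in> pverts G" and h: "h \<in> pverts H"
    \<comment> \<open>Only \<open>(d, v)\<close> and the points \<open>(d, h)\<close> with
      \<open>h\<close> adjacent to \<open>v\<close> can suffer from the deletion: the first and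
      fourth cases.\<close>
    consider "h = v" "g = d" | "h = v" "g \<noteq> d" | "h \<in> nbrs H v" "g \<noteq> d" | "h \<in> nbrs H v" "g = d"
      | "h \<notin> insert v (nbrs H v)"
      by blast
    then show "(g, h) \<in> ?F \<or> (\<exists>h'. (g, h') \<in> ?F \<and> (h, h') \<in> parcs H) \<or>
      (\<exists>g'. (g', h) \<in> ?F \<and> (g, g') \<in> parcs G)"
    proof cases
      case 1
      obtain g' where "(d, g') \<in> parcs G"
        using G.no_isolated[OF dV] unfolding nbrs_def by blast
      then show ?thesis
        using 1 G.adj_irrefl G.in_arcsD2 by blast
    next
      case 2
      then show ?thesis using g by blast
    next
      case 3
      then show ?thesis using g H.adj_sym unfolding nbrs_def by blast
    next
      case 4
      then have "nbrs H h \<noteq> {v}" using no_leaf unfolding leaves_def by blast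
      moreover have "v \<in> nbrs H h" using 4 H.nbrs_sym by blast
      ultimately obtain h' where h': "h' \<in> nbrs H h" "h' \<noteq> v" by blast
      \<comment> \<open>So \<open>h'\<close> lies outside the closed neighbourhood of
        \<open>v\<close>, where the copy of \<open>D\<close> is intact.\<close>
      have "h' \<notin> nbrs H v" using 4 h' H.nbrs_triangle_free by blast
      then have "(d, h') \<in> ?F" using h' d H.nbrs_subset by blast
      then show ?thesis using 4 h' unfolding nbrs_def by blast
    next
      case 5
      then show ?thesis using g h dom unfolding dominating_set_def by blast
    qed
  qed
  then have "card D * card (pverts H) \<le> card ?F"
    by (rule card_dominating[OF D])
  also have "card ?F < card (star_layers D v)"
  proof (rule card_Diff1_less)
    show "finite (star_layers D v)"
      using G.pair_finite_verts H.pair_finite_verts dom finite_subset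
      unfolding dominating_set_def by blast
    show "(d, v) \<in> star_layers D v" using dV by blast
  qed
  finally show False
    using card_star_layers[OF DV v] tight by simp
qed

lemma tight:
  assumes D: "privately_dominating G D" and E: "privately_dominating H E"
  obtains k where
    "\<And>g. g \<in> pverts G \<Longrightarrow> card (nbrs G g) \<le> k"
    "\<And>h. h \<in> pverts H \<Longrightarrow> card (nbrs H h) \<le> k"
    "card (pverts G) = card D * (k + 1)" "card (pverts H) = card E * (k + 1)"
proof -
  interpret S: well_dominated_product H G by (rule swap)
  have domD: "dominating_set G D" and domE: "dominating_set H E"
    using D E unfolding privately_dominating_def by blast+
  have pos: "card D > 0" "card E > 0"
    using G.dominating_set_nonempty[OF domD] H.dominating_set_nonempty[OF domE] domD domE
      finite_subset[OF _ G.pair_finite_verts] finite_subset[OF _ H.pair_finite_verts]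
    unfolding dominating_set_def by (auto simp: card_gt_0_iff)
  define k where "k = Max ((\<lambda>g. card (nbrs G g)) ` pverts G)"
  define l where "l = Max ((\<lambda>h. card (nbrs H h)) ` pverts H)"
  have k: "card (nbrs G g) \<le> k" if "g \<in> pverts G" for g
    using that G.pair_finite_verts unfolding k_def by simp
  have l: "card (nbrs H h) \<le> l" if "h \<in> pverts H" for h
    using that H.pair_finite_verts unfolding l_def by simp
  have "k \<in> (\<lambda>g. card (nbrs G g)) ` pverts G"
    unfolding k_def using G.pair_finite_verts G.nonempty by (intro Max_in) auto
  then obtain a where a: "a \<in> pverts G" "card (nbrs G a) = k"
    by blast
  have "l \<in> (\<lambda>h. card (nbrs H h)) ` pverts H"
    unfolding l_def using H.pair_finite_verts H.nonempty by (intro Max_in) auto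
  then obtain b where b: "b \<in> pverts H" "card (nbrs H b) = l"
    by blast
  \<comment> \<open>The lower bound uses a vertex of maximum degree in the other factor, the upper
    bound the maximum degree of the factor itself. Cancelling \<open>card D\<close> and
    \<open>card E\<close> then compares \<open>k\<close> and \<open>l\<close> in both
    directions.\<close>
  have nG: "card D * (l + 1) \<le> card (pverts G)" "card (pverts G) \<le> card D * (k + 1)"
    using degree_bound[OF D b(1)] G.card_verts_le[OF domD k] b(2) by auto
  have nH: "card E * (k + 1) \<le> card (pverts H)" "card (pverts H) \<le> card E * (l + 1)"
    using S.degree_bound[OF E a(1)] H.card_verts_le[OF domE l] a(2) by auto
  have "l \<le> k"
    using order_trans[OF nG] pos by simp
  moreover have "k \<le> l"
    using order_trans[OF nH] pos by simp
  ultimately have "k = l" by simp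
  then show ?thesis
    using k l nG nH by (intro that[of k]) simp_all
qed

text \<open>
  The competitor to the union of the layers over \<open>E\<close>: around the code vertex \<open>v\<close>, the layer over
  \<open>v\<close> is replaced by copies of \<open>a\<close> over the neighbours of \<open>v\<close> and by what is still needed over \<open>v\<close>.
\<close>
abbreviation modified_layers :: "'b set \<Rightarrow> 'a \<Rightarrow> 'b \<Rightarrow> ('a \<times> 'b) set" where
  "modified_layers E a v \<equiv> {a} \<times> nbrs H v \<union>
     (pverts G - insert a (nbrs G a) \<union> leaves G a) \<times> {v} \<union> pverts G \<times> (E - {v})"

text \<open>The set \<open>modified_layers E a v\<close> is a minimal dominating set, so it has as
  many elements as V(G) x E. Cancelling the layers over \<open>E - {v}\<close> leaves the
  identity.\<close>

lemma degree_leaves: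
  assumes E: "privately_dominating H E" and v: "v \<in> E" and a: "a \<in> pverts G"
    and leaf: "\<And>e. e \<in> E \<Longrightarrow> leaves H e \<noteq> {}"
    and disj: "\<And>d e. d \<in> E \<Longrightarrow> e \<in> E \<Longrightarrow> d \<noteq> e \<Longrightarrow>
      insert d (nbrs H d) \<inter> insert e (nbrs H e) = {}"
  shows "card (nbrs H v) + card (leaves G a) = card (nbrs G a) + 1"
proof -
  interpret S: well_dominated_product H G by (rule swap)
  let ?M = "modified_layers E a v"
  have dom: "dominating_set H E" using E unfolding privately_dominating_def by blast
  then have EV: "E \<subseteq> pverts H" unfolding dominating_set_def by blast
  then have finE: "finite E" using H.pair_finite_verts finite_subset by blast
  have leaf_sub: "leaves G a \<subseteq> nbrs G a" unfolding leaves_def by blast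
  \<comment> \<open>Disjoint closed neighbourhoods make \<open>E\<close> independent.\<close>
  have nbrs_notin: "u \<notin> E" if "u \<in> nbrs H e" "e \<in> E" for u e
    using disj[OF that(2), of u] that H.nbrs_irrefl by blast
  have "minimal_dominating_set (cartesian_product G H) ?M"
  proof (rule minimal_dominating_setI)
    show "dominating_set (cartesian_product G H) ?M"
      unfolding dominating_set_cartesian_product_iff
    proof (intro conjI ballI)
      show "?M \<subseteq> pverts G \<times> pverts H"
        using a v EV H.nbrs_subset G.nbrs_subset leaf_sub by blast
    next
      fix g h assume g: "g \<in> pverts G" and h: "h \<in> pverts H"
      obtain e where e: "e \<in> E" "h = e \<or> (h, e) \<in> parcs H"
        using dom h unfolding dominating_set_def by blast
      consider "e \<noteq> v" | "h = v" "g = a" | "h = v" "g \<in> nbrs G a" "nbrs G g = {a}"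
        | "h = v" "g \<in> nbrs G a" "nbrs G g \<noteq> {a}" | "h = v" "g \<notin> insert a (nbrs G a)"
        | "(h, v) \<in> parcs H" "g = a" | "(h, v) \<in> parcs H" "g \<in> nbrs G a"
        | "(h, v) \<in> parcs H" "g \<notin> insert a (nbrs G a)"
        using e by blast
      then show "(g, h) \<in> ?M \<or> (\<exists>h'. (g, h') \<in> ?M \<and> (h, h') \<in> parcs H) \<or>
        (\<exists>g'. (g', h) \<in> ?M \<and> (g, g') \<in> parcs G)"
      proof cases
        case 1
        then show ?thesis using e g by blast
      next
        case 2
        obtain u where "u \<in> nbrs H v" using H.no_isolated EV v by blast
        then show ?thesis using 2 unfolding nbrs_def by blast
      next
        case 3
        then show ?thesis unfolding leaves_def by blast
      next
        case 4
        have "a \<in> nbrs G g" using 4 G.nbrs_sym by blast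
        \<comment> \<open>Another neighbour of \<open>g\<close> is not adjacent to \<open>a\<close>,
          as there are no triangles, so its copy over \<open>v\<close> was kept.\<close>
        then obtain g' where g': "g' \<in> nbrs G g" "g' \<noteq> a" using 4 by blast
        then have "g' \<in> pverts G - insert a (nbrs G a)"
          using 4 G.nbrs_triangle_free G.nbrs_subset by blast
        then show ?thesis using 4 g' unfolding nbrs_def by blast
      next
        case 5
        then show ?thesis using g by blast
      next
        case 6
        then have "h \<in> nbrs H v" using H.adj_sym unfolding nbrs_def by blast
        then show ?thesis using 6 by blast
      next
        case 7
        then have "h \<in> nbrs H v" using H.adj_sym unfolding nbrs_def by blast
        then have "(a, h) \<in> ?M" by blast
        moreover have "(g, a) \<in> parcs G" using 7 G.adj_sym unfolding nbrs_def by blast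
        ultimately show ?thesis by blast
      next
        case 8
        then show ?thesis using g by blast
      qed
    qed
  next
    fix x assume "x \<in> ?M"
    \<comment> \<open>The points left undominated are, in this order: \<open>(a, u)\<close> itself;
      \<open>(g, u)\<close> for any neighbour \<open>u\<close> of \<open>v\<close>;
      \<open>(g, v)\<close> itself; \<open>(g, u)\<close> for a leaf \<open>u\<close> at
      \<open>e\<close>.\<close>
    then consider (nbr) u where "x = (a, u)" "u \<in> nbrs H v"
      | (far) g where "x = (g, v)" "g \<in> pverts G - insert a (nbrs G a)"
      | (leaf) g where "x = (g, v)" "g \<in> leaves G a"
      | (layer) g e where "x = (g, e)" "g \<in> pverts G" "e \<in> E" "e \<noteq> v"
      by blast
    then show "\<not> dominating_set (cartesian_product G H) (?M - {x})"
    proof cases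
      case nbr
      have u: "u \<in> pverts H" "u \<noteq> v" "u \<notin> E"
        using nbr(2) H.nbrs_subset H.nbrs_irrefl nbrs_notin v by blast+
      have "(a, h') \<notin> ?M" if "(u, h') \<in> parcs H" for h'
      proof
        assume "(a, h') \<in> ?M"
        then consider "h' \<in> nbrs H v" | "h' \<in> E - {v}"
          using G.nbrs_irrefl leaf_sub by blast
        then show False
        proof cases
          case 1
          then show ?thesis
            using that nbr(2) H.triangle_free unfolding nbrs_def by blast
        next
          case 2
          have "u \<in> nbrs H h'" using that H.adj_sym unfolding nbrs_def by blast
          then show ?thesis
            using 2 disj[of v h'] v nbr(2) by blast
        qed
      qed
      moreover have "(g', u) \<notin> ?M" if "(a, g') \<in> parcs G" for g'
        using that u G.adj_irrefl by blast
      ultimately show ?thesis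
        using a u nbr(1) by (intro not_dominating_cartesian_productI[of a _ u]) blast+
    next
      case far
      obtain u where u: "u \<in> nbrs H v" using H.no_isolated EV v by blast
      have u': "u \<in> pverts H" "u \<noteq> v" "u \<notin> E"
        using u H.nbrs_subset H.nbrs_irrefl nbrs_notin v by blast+
      have "(g, u) \<notin> ?M" using far u' by blast
      moreover have "(g, h') \<notin> ?M - {x}" if "(u, h') \<in> parcs H" for h'
      proof
        assume "(g, h') \<in> ?M - {x}"
        then have h': "h' \<in> E - {v}" using far leaf_sub by blast
        have "u \<in> nbrs H h'" using that H.adj_sym unfolding nbrs_def by blast
        then show False
          using h' disj[of v h'] v u by blast
      qed
      moreover have "(g', u) \<notin> ?M" if "(g, g') \<in> parcs G" for g'
      proof
        assume "(g', u) \<in> ?M"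
        then have "g' = a" using u' by blast
        then show False using that far G.adj_sym unfolding nbrs_def by blast
      qed
      ultimately show ?thesis
        using far u' by (intro not_dominating_cartesian_productI[of g _ u]) blast+
    next
      case leaf
      have g: "g \<in> pverts G" "g \<noteq> a" "nbrs G g = {a}"
        using leaf(2) G.nbrs_subset G.nbrs_irrefl unfolding leaves_def by blast+
      have "(g, h') \<notin> ?M" if "(v, h') \<in> parcs H" for h'
      proof -
        have "h' \<in> nbrs H v" using that unfolding nbrs_def by blast
        then show ?thesis using g v nbrs_notin H.nbrs_irrefl by blast
      qed
      moreover have "(g', v) \<notin> ?M" if "(g, g') \<in> parcs G" for g'
      proof -
        have "g' = a" using that g(3) unfolding nbrs_def by blast
        then show ?thesis using H.nbrs_irrefl G.nbrs_irrefl leaf_sub by blast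
      qed
      ultimately show ?thesis
        using leaf(1) g(1) v EV by (intro not_dominating_cartesian_productI[of g _ v]) blast+
    next
      case layer
      obtain u where u: "u \<in> nbrs H e" "nbrs H u = {e}"
        using leaf[OF layer(3)] unfolding leaves_def by blast
      have u': "u \<in> pverts H" "u \<notin> E"
        using u H.nbrs_subset nbrs_notin layer(3) by blast+
      have "u \<noteq> v" "u \<notin> nbrs H v"
        using u'(2) v disj[OF v layer(3)] layer(4) u(1) by blast+
      then have "(g', u) \<notin> ?M" for g' using u' by blast
      moreover have "h' = e" if "(u, h') \<in> parcs H" for h'
        using that u(2) unfolding nbrs_def by blast
      ultimately show ?thesis
        using layer u' by (intro not_dominating_cartesian_productI[of g _ u]) blast+
    qed
  qed
  \<comment> \<open>Since \<open>E\<close> lives in the second factor, its layers are compared in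
    the exchanged product.\<close>
  then have "minimal_dominating_set (cartesian_product H G) (prod.swap ` ?M)"
    by (rule minimal_dominating_set_cartesian_product_swap)
  then have "card (prod.swap ` ?M) = card E * card (pverts G)"
    by (rule S.card_minimal[OF E])
  then have "card ?M = card E * card (pverts G)"
    by (metis card_image inj_swap)
  moreover have "card ?M = card (nbrs H v) +
    (card (pverts G) - (card (nbrs G a) + 1) + card (leaves G a)) + card (pverts G) * (card E - 1)"
  proof -
    let ?A = "{a} \<times> nbrs H v" and ?C = "pverts G \<times> (E - {v})"
    let ?far = "pverts G - insert a (nbrs G a)"
    let ?B = "(?far \<union> leaves G a) \<times> {v}"
    have fin: "finite (leaves G a)"
      using finite_subset[OF leaf_sub G.finite_nbrs] .
    have finB: "finite ?A" "finite ?B" "finite ?C"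
      using fin finE G.pair_finite_verts H.finite_nbrs by auto
    have "?A \<inter> ?B = {}" using H.nbrs_irrefl by blast
    moreover have "(?A \<union> ?B) \<inter> ?C = {}" using nbrs_notin v by blast
    ultimately have "card ?M = card ?A + card ?B + card ?C"
      using finB by (simp add: card_Un_disjoint)
    moreover have "card (?far \<union> leaves G a) = card ?far + card (leaves G a)"
      using fin leaf_sub by (intro card_Un_disjoint) (auto simp: G.pair_finite_verts)
    moreover have "card ?far = card (pverts G) - (card (nbrs G a) + 1)"
      using a G.nbrs_subset
      by (subst card_Diff_subset) (auto simp: G.finite_nbrs G.nbrs_irrefl)
    ultimately show ?thesis
      using v finE by (simp add: card_cartesian_product)
  qed
  \<comment> \<open>Ensures that the subtraction in the count above is not truncated.\<close>
  moreover have "card (nbrs G a) + 1 \<le> card (pverts G)"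
    using card_mono[OF G.pair_finite_verts, of "insert a (nbrs G a)"] a G.nbrs_subset
    by (simp add: G.card_insert_nbrs)
  moreover have "card E * card (pverts G) = card (pverts G) + card (pverts G) * (card E - 1)"
  proof -
    have "card E > 0" using v finE card_gt_0_iff by blast
    then show ?thesis by (cases "card E") auto
  qed
  ultimately show ?thesis by linarith
qed

text \<open>No vertex is isolated, so it suffices that \<open>k\<close> is at most 1. Otherwise the
  leaf count forces a path \<open>b\<close>, \<open>d\<close>, \<open>c\<close>, \<open>b'\<close>
  with leaf ends and \<open>d\<close> in \<open>D\<close>, and \<open>b'\<close> cannot be dominated
  by \<open>D\<close>.\<close>

lemma regular_one:
  assumes "g \<in> pverts G"
  shows "card (nbrs G g) = 1"
proof -
  interpret S: well_dominated_product H G by (rule swap)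
  obtain D E where D: "privately_dominating G D" and E: "privately_dominating H E"
    using G.privately_dominating_exists H.privately_dominating_exists by blast
  obtain k where
    k: "\<And>g. g \<in> pverts G \<Longrightarrow> card (nbrs G g) \<le> k" "\<And>h. h \<in> pverts H \<Longrightarrow> card (nbrs H h) \<le> k"
    and n: "card (pverts G) = card D * (k + 1)" "card (pverts H) = card E * (k + 1)"
    using tight[OF D E] by blast
  have domD: "dominating_set G D" and domE: "dominating_set H E"
    using D E unfolding privately_dominating_def by blast+
  then have DV: "D \<subseteq> pverts G" and EV: "E \<subseteq> pverts H"
    unfolding dominating_set_def by blast+
  have "\<forall>g \<in> pverts G. card (nbrs G g) \<le> k" "\<forall>h \<in> pverts H. card (nbrs H h) \<le> k"
    using k by blast+
  note codeG = G.perfect_code[OF domD this(1) n(1)] and codeH = H.perfect_code[OF domE this(2) n(2)]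
  have leafH: "leaves H e \<noteq> {}" if "e \<in> E" for e
    using leaves_nonempty[OF D, of e] codeH(1)[OF that] n(1) EV that by auto
  have leafG: "leaves G d \<noteq> {}" if "d \<in> D" for d
    using S.leaves_nonempty[OF E, of d] codeG(1)[OF that] n(2) DV that by auto
  obtain v where v: "v \<in> E" using H.dominating_set_nonempty[OF domE] by blast
  obtain d where d: "d \<in> D" using G.dominating_set_nonempty[OF domD] by blast
  have count: "k + card (leaves G a) = card (nbrs G a) + 1" if "a \<in> pverts G" for a
    using degree_leaves[OF E v that leafH codeH(2)] codeH(1)[OF v] by simp
  have pos: "card (nbrs G a) \<ge> 1" if "a \<in> pverts G" for a
    using G.no_isolated[OF that] G.finite_nbrs[of a] by (simp add: Suc_le_eq card_gt_0_iff)
  have "k \<le> 1"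
  proof (rule ccontr)
    assume "\<not> k \<le> 1"
    have deg_d: "card (nbrs G d) = k" by (rule codeG(1)[OF d])
    obtain b where b: "b \<in> nbrs G d" "nbrs G b = {d}"
      using leafG[OF d] unfolding leaves_def by blast
    \<comment> \<open>The only neighbour \<open>d\<close> of \<open>b\<close> has degree
      \<open>k\<close> > 1, so it is not a leaf; \<open>count\<close> at \<open>b\<close> then reads
      k + 0 = 2.\<close>
    have "leaves G b = {}"
      using b deg_d \<open>\<not> k \<le> 1\<close> unfolding leaves_def by auto
    moreover have "b \<in> pverts G" using b G.nbrs_subset by blast
    ultimately have k2: "k = 2"
      using count[of b] b by simp
    have "card (leaves G d) = 1"
      using count[of d] d DV deg_d by auto
    then have "leaves G d \<noteq> nbrs G d"
      using deg_d k2 by auto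
    then obtain c where c: "c \<in> nbrs G d" "nbrs G c \<noteq> {d}"
      unfolding leaves_def by blast
    have cV: "c \<in> pverts G" using c G.nbrs_subset by blast
    have "d \<in> nbrs G c" using c G.nbrs_sym by blast
    then have "card (nbrs G c) \<noteq> 1"
      using c(2) by (metis card_1_singletonE singletonD)
    \<comment> \<open>The degree of \<open>c\<close> is at least 2, so \<open>count\<close> at
      \<open>c\<close> yields a leaf.\<close>
    then have "card (leaves G c) \<noteq> 0"
      using count[OF cV] k(1)[OF cV] pos[OF cV] k2 by linarith
    then obtain b' where b': "b' \<in> nbrs G c" "nbrs G b' = {c}"
      unfolding leaves_def by (metis (mono_tags, lifting) card.empty empty_Collect_eq)
    have "b' \<in> pverts G" using b' G.nbrs_subset by blast
    then consider "b' \<in> D" | d' where "d' \<in> D" "b' \<in> nbrs G d'"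
      using domD unfolding G.dominating_set_iff by blast
    then show False
    proof cases
      case 1
      then show False using codeG(1) b'(2) k2 by fastforce
    next
      case 2
      \<comment> \<open>Only \<open>c\<close> could dominate \<open>b'\<close>, but \<open>c\<close>
        is adjacent to the code vertex \<open>d\<close>.\<close>
      then have "d' = c" using b'(2) G.nbrs_sym by blast
      then have "c \<in> D" using 2 by blast
      moreover have "c \<noteq> d" using c G.nbrs_irrefl by blast
      ultimately show False using codeG(2)[OF d] c(1) by blast
    qed
  qed
  then show ?thesis
    using k(1)[OF assms] pos[OF assms] by simp
qed

end

section \<open>The characterisation\<close>

lemma (in pair_graph) girth_ge_4_triangle_free:
  assumes girth: "girth G \<ge> 4" and uv: "(u, v) \<in> parcs G" and vw: "(v, w) \<in> parcs G"
  shows "(u, w) \<notin> parcs G"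
proof
  assume uw: "(u, w) \<in> parcs G"
  have wu: "(w, u) \<in> parcs G"
    using uw sym_arcs by (auto simp: symmetric_def dest: symD)
  let ?p = "[(u, v), (v, w), (w, u)]"
  have "u \<noteq> v" "v \<noteq> w" "w \<noteq> u"
    using uv vw wu no_loops' by blast+
  then have "pre_digraph.cycle (with_proj G) ?p"
    unfolding cycle_def using uv vw wu in_arcsD1
    by (intro exI[of _ u]) (auto simp: awalk_def)
  then have "girth G \<le> enat (length ?p)"
    unfolding girth_def by (intro INF_lower) simp
  also have "\<dots> < 4"
    by (simp add: numeral_eq_enat)
  finally show False using girth by simp
qed

text \<open>\<open>connected\<close> speaks of the symmetric closure, which has the same
  reachability since the arcs are symmetric; no walk leaves \<open>S\<close>.\<close>

lemma (in pair_graph) connected_closed: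
  assumes conn: "connected (with_proj G)" and "S \<subseteq> pverts G" and "S \<noteq> {}"
    and closed: "\<And>x. x \<in> S \<Longrightarrow> nbrs G x \<subseteq> S"
  shows "S = pverts G"
proof -
  obtain u where u: "u \<in> S" using assms by blast
  have "v \<in> S" if v: "v \<in> pverts G" for v
  proof -
    have "u \<rightarrow>\<^sup>*\<^bsub>mk_symmetric (with_proj G)\<^esub> v"
      using conn u v assms(2) unfolding connected_def strongly_connected_def by auto
    then have "u \<rightarrow>\<^sup>*\<^bsub>with_proj G\<^esub> v"
      using reachable_mk_symmetric_eq[OF sym_arcs] by simp
    then show ?thesis
    proof (induction rule: reachable_induct)
      case base
      then show ?case using u by blast
    next
      case (step x y)
      then show ?case using closed unfolding nbrs_def by auto
    qed
  qed
  then show ?thesis using assms(2) by blast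
qed

lemma triangle_free_graphI:
  assumes "pair_graph G" "card (pverts G) \<ge> 2" "connected (with_proj G)" "girth G \<ge> 4"
  shows "triangle_free_graph G"
proof -
  interpret pair_graph G by fact
  show ?thesis
  proof
    show "(u, w) \<notin> parcs G" if "(u, v) \<in> parcs G" "(v, w) \<in> parcs G" for u v w
      using girth_ge_4_triangle_free[OF assms(4) that] .
    show "nbrs G v \<noteq> {}" if "v \<in> pverts G" for v
    proof
      assume "nbrs G v = {}"
      then have "{v} = pverts G"
        using connected_closed[OF assms(3), of "{v}"] that by blast
      then show False using assms(2) by (simp flip: \<open>{v} = pverts G\<close>)
    qed
    show "pverts G \<noteq> {}" using assms(2) by auto
  qed
qed

text \<open>When all degrees are 1, a vertex and its neighbour form a set closed under adjacency,
  hence the whole connected graph.\<close>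

lemma (in triangle_free_graph) complete_digraph_2I:
  assumes conn: "connected (with_proj G)" and reg: "\<And>g. g \<in> pverts G \<Longrightarrow> card (nbrs G g) = 1"
  shows "complete_digraph 2 (with_proj G)"
proof -
  obtain u where u: "u \<in> pverts G" using nonempty by blast
  obtain v where v: "nbrs G u = {v}" using reg[OF u] card_1_singletonE by blast
  have vV: "v \<in> pverts G" using v nbrs_subset by blast
  have "u \<in> nbrs G v" using v nbrs_sym by blast
  then have u': "nbrs G v = {u}" using reg[OF vV] by (metis card_1_singletonE singletonD)
  have verts: "{u, v} = pverts G"
    by (rule connected_closed[OF conn]) (use u vV v u' in auto)
  have "u \<noteq> v" using v nbrs_irrefl by blast
  moreover have "parcs G = {(u, v), (v, u)}"
  proof -
    have "(x, y) \<in> parcs G \<longleftrightarrow> x = u \<and> y = v \<or> x = v \<and> y = u" for x y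
    proof -
      have "x \<in> {u, v}" if "(x, y) \<in> parcs G"
        using that in_arcsD1 verts by blast
      moreover have "(u, y) \<in> parcs G \<longleftrightarrow> y = v" "(v, y) \<in> parcs G \<longleftrightarrow> y = u"
        using v u' unfolding nbrs_def by blast+
      ultimately show ?thesis by blast
    qed
    then show ?thesis by auto
  qed
  ultimately show ?thesis
    unfolding complete_digraph_pair_def verts[symmetric] by auto
qed

lemma complete_digraph_2E:
  assumes "complete_digraph 2 (with_proj G)"
  obtains a b where "a \<noteq> b" "pverts G = {a, b}" "parcs G = {(a, b), (b, a)}"
proof -
  have "card (pverts G) = 2"
    and arcs: "parcs G = {(u, v). (u, v) \<in> pverts G \<times> pverts G \<and> u \<noteq> v}"
    using assms unfolding complete_digraph_pair_def by auto
  then obtain a b where "a \<noteq> b" "pverts G = {a, b}"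
    unfolding card_2_iff by blast
  then show ?thesis using that arcs by auto
qed

text \<open>The product is a 4-cycle: any two distinct vertices dominate it and fewer never do, so
  minimal dominating sets have exactly 2 elements.\<close>

lemma well_dominated_C4:
  assumes G: "complete_digraph 2 (with_proj G)" and H: "complete_digraph 2 (with_proj H)"
  shows "well_dominated (cartesian_product G H)"
proof -
  obtain a b where G: "a \<noteq> b" "pverts G = {a, b}" "parcs G = {(a, b), (b, a)}"
    using complete_digraph_2E[OF G] by blast
  obtain c d where H: "c \<noteq> d" "pverts H = {c, d}" "parcs H = {(c, d), (d, c)}"
    using complete_digraph_2E[OF H] by blast
  have pair: "dominating_set (cartesian_product G H) {x, y}"
    if "x \<in> {a, b} \<times> {c, d}" "y \<in> {a, b} \<times> {c, d}" "x \<noteq> y" for x y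
    using that unfolding dominating_set_cartesian_product_iff G H by auto
  \<comment> \<open>Inclusion in \<open>{x}\<close> also covers the empty set.\<close>
  have single: "\<not> dominating_set (cartesian_product G H) D" if "D \<subseteq> {x}" for x D
    using that G(1) H(1) unfolding dominating_set_cartesian_product_iff G(2,3) H(2,3)
    by (cases x) auto
  have "card D = 2" if min: "minimal_dominating_set (cartesian_product G H) D" for D
  proof -
    have dom: "dominating_set (cartesian_product G H) D"
      using min unfolding minimal_dominating_set_def by blast
    then have sub: "D \<subseteq> {a, b} \<times> {c, d}"
      unfolding dominating_set_cartesian_product_iff G H by blast
    obtain x where x: "x \<in> D" using dom single[of D] by blast
    obtain y where y: "y \<in> D" "y \<noteq> x" using dom single[of D x] by blast
    have "dominating_set (cartesian_product G H) {x, y}"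
      using pair x y sub by blast
    then have "\<not> {x, y} \<subset> D"
      using min unfolding minimal_dominating_set_def by blast
    moreover have "{x, y} \<subseteq> D"
      using x y by simp
    ultimately have "D = {x, y}" by (simp only: psubset_eq simp_thms)
    then show ?thesis using y by simp
  qed
  then show ?thesis unfolding well_dominated_def by simp
qed

theorem theorem2:
  fixes G :: "'a pair_pre_digraph" and H :: "'b pair_pre_digraph"
  assumes "pair_graph G" and "pair_graph H"
    and "card (pverts G) \<ge> 2" and "card (pverts H) \<ge> 2"
    and "connected (with_proj G)" and "connected (with_proj H)"
    and "girth G \<ge> 4" and "girth H \<ge> 4"
  shows "well_dominated (cartesian_product G H) \<longleftrightarrow>
    complete_digraph 2 (with_proj G) \<and> complete_digraph 2 (with_proj H)"
proof
  interpret G: triangle_free_graph G using assms by (intro triangle_free_graphI)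
  interpret H: triangle_free_graph H using assms by (intro triangle_free_graphI)
  assume "well_dominated (cartesian_product G H)"
  then interpret GH: well_dominated_product G H by unfold_locales
  interpret HG: well_dominated_product H G by (rule GH.swap)
  show "complete_digraph 2 (with_proj G) \<and> complete_digraph 2 (with_proj H)"
    using G.complete_digraph_2I H.complete_digraph_2I GH.regular_one HG.regular_one assms
    by blast
next
  assume "complete_digraph 2 (with_proj G) \<and> complete_digraph 2 (with_proj H)"
  then show "well_dominated (cartesian_product G H)"
    using well_dominated_C4 by blast
qed

end
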